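(* Let $A(t)\in\mathbb{C}^{p\times p}$, $t\in\mathbb{R}$, be an almost periodic matrix, let $P$ be a constant projection matrix that commutes with $\Phi_A$, and assume that for some given positive constants $c$ and $\alpha$ the inequality $$\|\Psi_A(t,s)P\|\le c\exp(-\alpha|t-s|)$$ is satisfied for all $(t,s)\in\mathbb{R}^2$ with $t>s$ (or for all $(t,s)\in\mathbb{R}^2$ with $t<s$). Then $\Psi_A$ is integrally Bi-almost automorphic on $]-\infty,t]$ and on $[t,\infty[$.
   Context: $\Phi_A(t)$ denotes a fundamental matrix of the system $y'=A(t)y$ and $\Psi_A(t,s)=\Phi_A(t)\Phi_A^{-1}(s)$. For $\xi\in\mathbb{R}$, $A_\xi(t)=A(t+\xi)$. A projection matrix is a matrix with $P^2=P$. A bounded continuous matrix function $A$ is (Bohr) almost periodic if for each $\epsilon>0$ there exists $l_\epsilon>0$ such that every interval of length $l_\epsilon$ contains a number $\xi$ with $\|A(t+\xi)-A(t)\|\le\epsilon$ for all $t\in\mathbb{R}$. A matrix function $A$ is almost automorphic if for any sequence $\{\xi'_n\}\subset\mathbb{R}$ there exist a subsequence $\{\xi_n\}$ and a matrix $B(t)$ such that $A(t+\xi_n)\to B(t)$ and $B(t-\xi_n)\to A(t)$ pointwise on $\mathbb{R}$. Every almost periodic matrix is almost automorphic. With $\{\xi_n\}$ and $B$ the subsequence and the matrix of this last definition, $\Psi_A$ is called integrally Bi-almost automorphic on $]-\infty,t]$ if the almost automorphy of $A$ implies $$\lim_{n\to\infty}\int_{-\infty}^t\big\|(\Psi_{A_{\xi_n}}-\Psi_B)(t,s)P\big\|\,ds=\lim_{n\to\infty}\int_{-\infty}^t\big\|(\Psi_{B_{-\xi_n}}-\Psi_A)(t,s)P\big\|\,ds=0,$$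 and integrally Bi-almost automorphic on $[t,\infty[$ if the almost automorphy of $A$ implies $$\lim_{n\to\infty}\int_t^{\infty}\big\|(\Psi_{A_{\xi_n}}-\Psi_B)(t,s)P\big\|\,ds=\lim_{n\to\infty}\int_t^{\infty}\big\|(\Psi_{B_{-\xi_n}}-\Psi_A)(t,s)P\big\|\,ds=0.$$
   Formalization: The alternatives are read respectively: the bound for t>s gives the property on ]-∞,t], the bound for t<s gives it on [t,∞[; one bound alone does not give both (p=1, A(t)=-1+cos t, P=1, ξ_n=1/n fails on [t,∞[). *)

theory Defs
  imports "HOL-Analysis.Analysis"
begin

text \<open>Matrices carry the library norm (Frobenius); all norms on a finite-dimensional
  space are equivalent, so only constants depend on this choice.\<close>

definition almost_periodic :: "(real \<Rightarrow> complex ^ 'p ^ 'p) \<Rightarrow> bool" where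
  "almost_periodic A \<longleftrightarrow>
     bounded (range A) \<and> continuous_on UNIV A \<and>
     (\<forall>\<epsilon>>0. \<exists>l>0. \<forall>a. \<exists>\<xi>\<in>{a..a + l}. \<forall>t. norm (A (t + \<xi>) - A t) \<le> \<epsilon>)"

definition aa_limit ::
    "(real \<Rightarrow> complex ^ 'p ^ 'p) \<Rightarrow> (nat \<Rightarrow> real) \<Rightarrow> (real \<Rightarrow> complex ^ 'p ^ 'p) \<Rightarrow> bool" where
  "aa_limit A \<xi> B \<longleftrightarrow>
     (\<forall>t. (\<lambda>n. A (t + \<xi> n)) \<longlonglongrightarrow> B t) \<and> (\<forall>t. (\<lambda>n. B (t - \<xi> n)) \<longlonglongrightarrow> A t)"

definition almost_automorphic :: "(real \<Rightarrow> complex ^ 'p ^ 'p) \<Rightarrow> bool" where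
  "almost_automorphic A \<longleftrightarrow> (\<forall>\<xi>' :: nat \<Rightarrow> real. \<exists>(r :: nat \<Rightarrow> nat) B. strict_mono r \<and> aa_limit A (\<xi>' \<circ> r) B)"

definition shift :: "(real \<Rightarrow> complex ^ 'p ^ 'p) \<Rightarrow> real \<Rightarrow> real \<Rightarrow> complex ^ 'p ^ 'p" where
  "shift A \<xi> t = A (t + \<xi>)"

definition fundamental_matrix ::
    "(real \<Rightarrow> complex ^ 'p ^ 'p) \<Rightarrow> (real \<Rightarrow> complex ^ 'p ^ 'p) \<Rightarrow> bool" where
  "fundamental_matrix A \<Phi> \<longleftrightarrow>
     (\<forall>t. (\<Phi> has_vector_derivative (A t ** \<Phi> t)) (at t)) \<and> (\<forall>t. invertible (\<Phi> t))"

text \<open>The value of \<open>Psi\<close> does not depend on the fundamental matrix chosen: two fundamental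
  matrices of the same system differ by a constant invertible factor on the right, which cancels.
  It is meaningful only when a fundamental matrix exists, as it does for continuous \<open>A\<close>.\<close>

definition Psi :: "(real \<Rightarrow> complex ^ 'p ^ 'p) \<Rightarrow> real \<Rightarrow> real \<Rightarrow> complex ^ 'p ^ 'p" where
  "Psi A t s = (let \<Phi> = (SOME \<Phi>. fundamental_matrix A \<Phi>) in \<Phi> t ** matrix_inv (\<Phi> s))"

text \<open>The limits are required for every pair \<open>(\<xi>, B)\<close> that almost automorphy of \<open>A\<close> can supply,
  and almost automorphy is included so that such pairs do exist.
  The integrals take values in \<open>[0, \<infinity>]\<close>: the Bochner integral would assign \<open>0\<close> to a
  non-integrable function, whereas here a divergent integral counts as \<open>\<infinity>\<close>.\<close>

definition integrally_bi_aa_past ::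
    "(real \<Rightarrow> complex ^ 'p ^ 'p) \<Rightarrow> complex ^ 'p ^ 'p \<Rightarrow> bool" where
  "integrally_bi_aa_past A P \<longleftrightarrow> almost_automorphic A \<and>
     (\<forall>\<xi> B. aa_limit A \<xi> B \<longrightarrow> (\<forall>t.
        (\<lambda>n. \<integral>\<^sup>+ s\<in>{..t}. ennreal (norm ((Psi (shift A (\<xi> n)) t s - Psi B t s) ** P)) \<partial>lborel)
           \<longlonglongrightarrow> 0 \<and>
        (\<lambda>n. \<integral>\<^sup>+ s\<in>{..t}. ennreal (norm ((Psi (shift B (- \<xi> n)) t s - Psi A t s) ** P)) \<partial>lborel)
           \<longlonglongrightarrow> 0))"

definition integrally_bi_aa_future ::
    "(real \<Rightarrow> complex ^ 'p ^ 'p) \<Rightarrow> complex ^ 'p ^ 'p \<Rightarrow> bool" where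
  "integrally_bi_aa_future A P \<longleftrightarrow> almost_automorphic A \<and>
     (\<forall>\<xi> B. aa_limit A \<xi> B \<longrightarrow> (\<forall>t.
        (\<lambda>n. \<integral>\<^sup>+ s\<in>{t..}. ennreal (norm ((Psi (shift A (\<xi> n)) t s - Psi B t s) ** P)) \<partial>lborel)
           \<longlonglongrightarrow> 0 \<and>
        (\<lambda>n. \<integral>\<^sup>+ s\<in>{t..}. ennreal (norm ((Psi (shift B (- \<xi> n)) t s - Psi A t s) ** P)) \<partial>lborel)
           \<longlonglongrightarrow> 0))"

end

theory Submission
  imports Defs
begin

text \<open>By Bochner's compactness argument, the translates of an almost periodic \<open>A\<close> are relatively
  compact for uniform convergence, so \<open>A\<^bsub>\<xi>\<^sub>n\<^esub> \<rightarrow> B\<close> pointwise already implies uniform convergence.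
  A Gronwall estimate turns this into \<open>\<Psi>\<close> of the translates converging to \<open>\<Psi>\<^sub>B\<close> pointwise, and the
  exponential bound passes from \<open>\<Psi>\<^sub>A\<close> to its translates and then to \<open>\<Psi>\<^sub>B\<close> and its translates. Dominated
  convergence with the majorant \<open>2 c exp (- \<alpha> \<bar>t - s\<bar>)\<close> gives the limits of the integrals.\<close>

subsection \<open>Matrices and a Gronwall inequality\<close>

text \<open>Cauchy-Schwarz bounds each entry by a row norm of \<open>A\<close> times a column norm
  of \<open>B\<close>; summing squares over columns and then over rows keeps the constant at
  1.\<close>

lemma norm_matrix_mult_le:
  fixes A :: "complex ^ 'n ^ 'm" and B :: "complex ^ 'p ^ 'n"
  shows "norm (A ** B) \<le> norm A * norm B"
proof -
  have entry: "norm ((A ** B) $ i $ j) \<le> norm (A $ i) * L2_set (\<lambda>k. norm (B $ k $ j)) UNIV" for i j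
  proof -
    have "norm ((A ** B) $ i $ j) \<le> (\<Sum>k\<in>UNIV. norm (A $ i $ k) * norm (B $ k $ j))"
      unfolding matrix_matrix_mult_def by (simp add: norm_mult[symmetric] norm_sum)
    also have "\<dots> \<le> norm (A $ i) * L2_set (\<lambda>k. norm (B $ k $ j)) UNIV"
      using L2_set_mult_ineq[of "\<lambda>k. norm (A $ i $ k)" "\<lambda>k. norm (B $ k $ j)" UNIV]
      by (simp add: norm_vec_def)
    finally show ?thesis .
  qed
  have swap: "L2_set (\<lambda>j. L2_set (\<lambda>k. norm (B $ k $ j)) UNIV) UNIV = norm B"
    unfolding norm_vec_def L2_set_def
    by (simp add: sum_nonneg) (rule sum.swap)
  have row: "norm ((A ** B) $ i) \<le> norm (A $ i) * norm B" for i
  proof -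
    have "norm ((A ** B) $ i) \<le> L2_set (\<lambda>j. norm (A $ i) * L2_set (\<lambda>k. norm (B $ k $ j)) UNIV) UNIV"
      unfolding norm_vec_def[of "(A ** B) $ i"] by (intro L2_set_mono entry) auto
    also have "\<dots> = norm (A $ i) * norm B"
      by (simp add: L2_set_right_distrib[symmetric] swap)
    finally show ?thesis .
  qed
  have "norm (A ** B) \<le> L2_set (\<lambda>i. norm (A $ i) * norm B) UNIV"
    unfolding norm_vec_def[of "A ** B"] by (intro L2_set_mono row) auto
  also have "\<dots> = norm A * norm B"
    by (simp add: L2_set_left_distrib[symmetric] norm_vec_def[of A])
  finally show ?thesis .
qed

text \<open>Gives the matrix product the generic rules for limits, derivatives and uniform
  limits.\<close>

lemma bounded_bilinear_matrix_mult:
  "bounded_bilinear ((**) :: complex ^ 'n ^ 'm \<Rightarrow> complex ^ 'p ^ 'n \<Rightarrow> complex ^ 'p ^ 'm)"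
proof
  fix A A' :: "complex ^ 'n ^ 'm" and B B' :: "complex ^ 'p ^ 'n" and r :: real
  show "(A + A') ** B = A ** B + A' ** B"
    by (simp add: matrix_matrix_mult_def vec_eq_iff distrib_right sum.distrib)
  show "A ** (B + B') = A ** B + A ** B'"
    by (rule matrix_add_ldistrib)
  show "(r *\<^sub>R A) ** B = r *\<^sub>R (A ** B)" "A ** (r *\<^sub>R B) = r *\<^sub>R (A ** B)"
    by (simp_all add: matrix_matrix_mult_def vec_eq_iff scaleR_right.sum)
  show "\<exists>K. \<forall>(A :: complex ^ 'n ^ 'm) (B :: complex ^ 'p ^ 'n). norm (A ** B) \<le> norm A * norm B * K"
    using norm_matrix_mult_le by (intro exI[of _ 1]) auto
qed

interpretation matrix_mult: bounded_bilinear
  "(**) :: complex ^ 'n ^ 'm \<Rightarrow> complex ^ 'p ^ 'n \<Rightarrow> complex ^ 'p ^ 'm"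
  by (rule bounded_bilinear_matrix_mult)

lemma invertible_matrix_inv:
  fixes X :: "complex ^ 'n ^ 'n"
  assumes "invertible X"
  shows "X ** matrix_inv X = mat 1" "matrix_inv X ** X = mat 1"
  using assms someI_ex[of "\<lambda>Y. X ** Y = mat 1 \<and> Y ** X = mat 1"]
  by (auto simp: invertible_def matrix_inv_def)

text \<open>The norm is squared to keep it differentiable at zeros of \<open>f\<close>; the Young inequality
  \<open>2 \<epsilon> \<parallel>f\<parallel> \<le> \<parallel>f\<parallel>\<^sup>2 + \<epsilon>\<^sup>2\<close> then accounts for the summand \<open>1\<close> in the exponent.\<close>

lemma gronwall_forward:
  fixes f :: "real \<Rightarrow> 'a :: real_inner"
  assumes "s \<le> t" and "L \<ge> 0"
    and der: "\<And>u. u \<in> {s..t} \<Longrightarrow> (f has_vector_derivative f' u) (at u)"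
    and bd: "\<And>u. u \<in> {s..t} \<Longrightarrow> norm (f' u) \<le> L * norm (f u) + \<epsilon>"
  shows "(norm (f t))\<^sup>2 \<le> exp ((2 * L + 1) * (t - s)) * ((norm (f s))\<^sup>2 + \<epsilon>\<^sup>2 * (t - s))"
proof -
  define a where "a = 2 * L + 1"
  \<comment> \<open>The squared norm of \<open>f\<close> grows at rate at most \<open>a\<close> with
    source \<open>\<epsilon>\<close> squared. The exponential is the integrating factor, and the
    subtracted linear term absorbs the source, so that \<open>h\<close> is nonincreasing.\<close>
  define h where "h u = exp (- a * (u - s)) * (f u \<bullet> f u) - \<epsilon>\<^sup>2 * (u - s)" for u
  have a0: "a \<ge> 0" using \<open>L \<ge> 0\<close> by (simp add: a_def)
  have "h t \<le> h s"
  proof (rule DERIV_nonpos_imp_nonincreasing[OF \<open>s \<le> t\<close>])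
    fix u assume u: "s \<le> u" "u \<le> t"
    have "(f has_derivative (\<lambda>x. x *\<^sub>R f' u)) (at u)"
      using der[of u] u by (simp add: has_vector_derivative_def)
    from has_derivative_inner[OF this this]
    have "((\<lambda>u. f u \<bullet> f u) has_real_derivative (2 * (f u \<bullet> f' u))) (at u)"
      unfolding has_field_derivative_def
      by (rule has_derivative_eq_rhs) (simp add: inner_commute fun_eq_iff)
    then have "(h has_real_derivative (exp (- a * (u - s)) * (2 * (f u \<bullet> f' u) - a * (f u \<bullet> f u)) - \<epsilon>\<^sup>2)) (at u)"
      unfolding h_def by (auto intro!: derivative_eq_intros simp: algebra_simps)
    moreover have "exp (- a * (u - s)) * (2 * (f u \<bullet> f' u) - a * (f u \<bullet> f u)) \<le> 1 * \<epsilon>\<^sup>2"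
    proof -
      have "f u \<bullet> f' u \<le> norm (f u) * (L * norm (f u) + \<epsilon>)"
        by (rule order_trans[OF norm_cauchy_schwarz mult_left_mono]) (use bd u in auto)
      moreover have "2 * (norm (f u) * \<epsilon>) \<le> (norm (f u))\<^sup>2 + \<epsilon>\<^sup>2"
        using sum_squares_bound[of "norm (f u)" \<epsilon>] by (simp add: mult_ac)
      ultimately have "2 * (f u \<bullet> f' u) - a * (f u \<bullet> f u) \<le> \<epsilon>\<^sup>2"
        by (simp add: a_def dot_square_norm algebra_simps power2_eq_square)
      then have "exp (- a * (u - s)) * (2 * (f u \<bullet> f' u) - a * (f u \<bullet> f u)) \<le> exp (- a * (u - s)) * \<epsilon>\<^sup>2"
        by (rule mult_left_mono) simp
      also have "\<dots> \<le> 1 * \<epsilon>\<^sup>2"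
        using a0 u by (intro mult_right_mono) auto
      finally show ?thesis .
    qed
    ultimately show "\<exists>y. (h has_real_derivative y) (at u) \<and> y \<le> 0"
      by (intro exI conjI) auto
  qed
  then have "exp (- a * (t - s)) * (norm (f t))\<^sup>2 \<le> (norm (f s))\<^sup>2 + \<epsilon>\<^sup>2 * (t - s)"
    by (simp add: h_def dot_square_norm)
  then have "exp (a * (t - s)) * (exp (- a * (t - s)) * (norm (f t))\<^sup>2)
      \<le> exp (a * (t - s)) * ((norm (f s))\<^sup>2 + \<epsilon>\<^sup>2 * (t - s))"
    by (intro mult_left_mono) auto
  then show ?thesis
    unfolding a_def[symmetric] by (simp add: mult.assoc[symmetric] exp_add[symmetric])
qed

text \<open>For \<open>t < s\<close>, time reversal reduces to the forward case. The hypothesis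
  \<open>bd\<close> is asked only on the segment, because the source term in
  \<open>norm_Psi_diff_le\<close> is controlled only there.\<close>

lemma gronwall:
  fixes f :: "real \<Rightarrow> 'a :: real_inner"
  assumes "L \<ge> 0"
    and der: "\<And>u. (f has_vector_derivative f' u) (at u)"
    and bd: "\<And>u. u \<in> closed_segment s t \<Longrightarrow> norm (f' u) \<le> L * norm (f u) + \<epsilon>"
  shows "(norm (f t))\<^sup>2 \<le> exp ((2 * L + 1) * \<bar>t - s\<bar>) * ((norm (f s))\<^sup>2 + \<epsilon>\<^sup>2 * \<bar>t - s\<bar>)"
proof (cases "s \<le> t")
  case True
  then show ?thesis
    using gronwall_forward[of s t L f f' \<epsilon>] assms by (simp add: closed_segment_eq_real_ivl)
next
  case False
  define g where "g u = f (- u)" for u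
  have der_g: "(g has_vector_derivative - f' (- u)) (at u)" for u
  proof -
    have "((f \<circ> uminus) has_vector_derivative ((-1) *\<^sub>R f' (- u))) (at u)"
      by (rule vector_diff_chain_at) (auto intro!: derivative_eq_intros der)
    then show ?thesis by (simp add: g_def[abs_def] comp_def)
  qed
  have "(norm (g (- t)))\<^sup>2
      \<le> exp ((2 * L + 1) * (- t - - s)) * ((norm (g (- s)))\<^sup>2 + \<epsilon>\<^sup>2 * (- t - - s))"
    by (rule gronwall_forward[OF _ \<open>L \<ge> 0\<close> der_g])
      (use False bd in \<open>auto simp: g_def closed_segment_eq_real_ivl\<close>)
  then show ?thesis using False by (simp add: g_def)
qed

subsection \<open>Transition matrices\<close>

text \<open>\<open>Psi\<close> rests on a choice, and the chosen \<open>\<Phi>\<close> need not be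
  \<open>X\<close>; the existence of \<open>X\<close> guarantees that the choice is a fundamental
  matrix.\<close>

lemma fundamental_matrix_Psi:
  assumes "fundamental_matrix A X"
  obtains \<Phi> where "fundamental_matrix A \<Phi>" "\<And>t s. Psi A t s = \<Phi> t ** matrix_inv (\<Phi> s)"
  by (rule that[of "SOME \<Phi>. fundamental_matrix A \<Phi>"])
    (use someI[of "fundamental_matrix A" X] assms in \<open>simp_all add: Psi_def Let_def\<close>)

lemma Psi_refl:
  assumes "fundamental_matrix A X"
  shows "Psi A t t = mat 1"
  by (rule fundamental_matrix_Psi[OF assms])
    (simp add: fundamental_matrix_def invertible_matrix_inv)

lemma Psi_comp:
  assumes "fundamental_matrix A X"
  shows "Psi A t u ** Psi A u s = Psi A t s"
proof -
  obtain \<Phi> where \<Phi>: "fundamental_matrix A \<Phi>" "\<And>t s. Psi A t s = \<Phi> t ** matrix_inv (\<Phi> s)"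
    using fundamental_matrix_Psi[OF assms] by blast
  have "Psi A t u ** Psi A u s = \<Phi> t ** (matrix_inv (\<Phi> u) ** \<Phi> u) ** matrix_inv (\<Phi> s)"
    by (simp add: \<Phi> matrix_mul_assoc)
  then show ?thesis
    using \<Phi> by (simp add: fundamental_matrix_def invertible_matrix_inv)
qed

lemma Psi_has_vector_derivative:
  assumes "fundamental_matrix A X"
  shows "((\<lambda>t. Psi A t s) has_vector_derivative (A t ** Psi A t s)) (at t)"
proof -
  obtain \<Phi> where \<Phi>: "fundamental_matrix A \<Phi>" "\<And>t s. Psi A t s = \<Phi> t ** matrix_inv (\<Phi> s)"
    using fundamental_matrix_Psi[OF assms] by blast
  have "((\<lambda>t. \<Phi> t ** matrix_inv (\<Phi> s)) has_vector_derivative (A t ** \<Phi> t) ** matrix_inv (\<Phi> s)) (at t)"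
    using \<Phi>(1) by (intro bounded_linear.has_vector_derivative[OF matrix_mult.bounded_linear_left])
      (auto simp: fundamental_matrix_def)
  then show ?thesis by (simp add: \<Phi>(2) matrix_mul_assoc)
qed

text \<open>Uniqueness for the initial value problem: the difference of the two solutions solves the
  same linear system and vanishes at \<open>s\<close>, so Gronwall with
  \<open>\<epsilon> = 0\<close> makes it zero.\<close>

lemma solution_eq_Psi:
  fixes Y :: "real \<Rightarrow> complex ^ 'p ^ 'p"
  assumes fm: "fundamental_matrix A X" and M: "\<And>t. norm (A t) \<le> M"
    and Y: "\<And>t. (Y has_vector_derivative (A t ** Y t)) (at t)" and Ys: "Y s = mat 1"
  shows "Y t = Psi A t s"
proof -
  have M0: "M \<ge> 0" using norm_ge_zero[of "A 0"] M[of 0] by linarith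
  have "(norm (Y t - Psi A t s))\<^sup>2
      \<le> exp ((2 * M + 1) * \<bar>t - s\<bar>) * ((norm (Y s - Psi A s s))\<^sup>2 + 0\<^sup>2 * \<bar>t - s\<bar>)"
  proof (rule gronwall[OF M0])
    fix u
    show "((\<lambda>u. Y u - Psi A u s) has_vector_derivative (A u ** Y u - A u ** Psi A u s)) (at u)"
      by (intro has_vector_derivative_diff Y Psi_has_vector_derivative[OF fm])
    show "norm (A u ** Y u - A u ** Psi A u s) \<le> M * norm (Y u - Psi A u s) + 0"
      unfolding matrix_mult.diff_right[symmetric]
      using order_trans[OF norm_matrix_mult_le mult_right_mono[OF M]] by simp
  qed
  then show ?thesis by (simp add: Psi_refl[OF fm] Ys)
qed

lemma fundamental_matrix_shift:
  assumes "fundamental_matrix A X"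
  shows "fundamental_matrix (shift A \<xi>) (\<lambda>t. X (t + \<xi>))"
  unfolding fundamental_matrix_def shift_def
proof (intro conjI allI)
  fix t
  have "((X \<circ> (\<lambda>t. t + \<xi>)) has_vector_derivative (1 *\<^sub>R (A (t + \<xi>) ** X (t + \<xi>)))) (at t)"
    by (rule vector_diff_chain_at)
      (use assms in \<open>auto intro!: derivative_eq_intros simp: fundamental_matrix_def\<close>)
  then show "((\<lambda>t. X (t + \<xi>)) has_vector_derivative A (t + \<xi>) ** X (t + \<xi>)) (at t)"
    by (simp add: comp_def)
qed (use assms in \<open>auto simp: fundamental_matrix_def\<close>)

text \<open>The choices behind \<open>Psi\<close> for \<open>A\<close> and for its translate are
  unrelated. Uniqueness identifies the results: the right-hand side solves the shifted system and is
  the identity at \<open>t = s\<close>.\<close>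

lemma Psi_shift:
  assumes fm: "fundamental_matrix A X" and M: "\<And>t. norm (A t) \<le> M"
  shows "Psi (shift A \<xi>) t s = Psi A (t + \<xi>) (s + \<xi>)"
proof (rule solution_eq_Psi[symmetric, OF fundamental_matrix_shift[OF fm]])
  fix t
  show "norm (shift A \<xi> t) \<le> M" by (simp add: shift_def M)
  have "(((\<lambda>t. Psi A t (s + \<xi>)) \<circ> (\<lambda>t. t + \<xi>)) has_vector_derivative
      (1 *\<^sub>R (A (t + \<xi>) ** Psi A (t + \<xi>) (s + \<xi>)))) (at t)"
    by (rule vector_diff_chain_at) (auto intro!: derivative_eq_intros Psi_has_vector_derivative[OF fm])
  then show "((\<lambda>t. Psi A (t + \<xi>) (s + \<xi>)) has_vector_derivative
      shift A \<xi> t ** Psi A (t + \<xi>) (s + \<xi>)) (at t)"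
    by (simp add: comp_def shift_def)
qed (rule Psi_refl[OF fm])

section \<open>Growth of transition matrices and their dependence on the coefficients\<close>

lemma norm_Psi_le:
  fixes A :: "real \<Rightarrow> complex ^ 'p ^ 'p"
  assumes fm: "fundamental_matrix A X" and M: "\<And>t. norm (A t) \<le> M"
  shows "(norm (Psi A t s))\<^sup>2 \<le> exp ((2 * M + 1) * \<bar>t - s\<bar>) * (norm (mat 1 :: complex ^ 'p ^ 'p))\<^sup>2"
proof -
  have M0: "M \<ge> 0" using norm_ge_zero[of "A 0"] M[of 0] by linarith
  have "(norm (Psi A t s))\<^sup>2
      \<le> exp ((2 * M + 1) * \<bar>t - s\<bar>) * ((norm (Psi A s s))\<^sup>2 + 0\<^sup>2 * \<bar>t - s\<bar>)"
    using order_trans[OF norm_matrix_mult_le mult_right_mono[OF M]]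
    by (intro gronwall[OF M0 Psi_has_vector_derivative[OF fm]]) simp
  then show ?thesis by (simp add: Psi_refl[OF fm])
qed

text \<open>The difference \<open>D\<close> of the transition matrices solves
  \<open>D' = A ** D + (A - B) ** Psi B\<close> with zero initial value. Gronwall with the last term
  as source makes the estimate linear in \<open>\<delta>\<close>.\<close>

lemma norm_Psi_diff_le:
  fixes A B :: "real \<Rightarrow> complex ^ 'p ^ 'p"
  assumes A: "fundamental_matrix A X" and B: "fundamental_matrix B Y"
    and MA: "\<And>t. norm (A t) \<le> M" and MB: "\<And>t. norm (B t) \<le> M"
    and AB: "\<And>t. norm (A t - B t) \<le> \<delta>"
  shows "norm (Psi A t s - Psi B t s)
    \<le> \<delta> * (norm (mat 1 :: complex ^ 'p ^ 'p) * sqrt \<bar>t - s\<bar> * exp ((2 * M + 1) * \<bar>t - s\<bar>))"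
proof -
  define N where "N = norm (mat 1 :: complex ^ 'p ^ 'p)"
  define e where "e = exp ((2 * M + 1) * \<bar>t - s\<bar>)"
  have M0: "M \<ge> 0" using norm_ge_zero[of "A 0"] MA[of 0] by linarith
  have \<delta>0: "\<delta> \<ge> 0" using norm_ge_zero[of "A 0 - B 0"] AB[of 0] by linarith
  have bd: "norm (Psi B u s) \<le> N * sqrt e" if "u \<in> closed_segment s t" for u
  proof -
    have "\<bar>u - s\<bar> \<le> \<bar>t - s\<bar>"
      using that by (auto simp: closed_segment_eq_real_ivl split: if_splits)
    then have "exp ((2 * M + 1) * \<bar>u - s\<bar>) \<le> e"
      unfolding e_def using M0 by (simp add: mult_left_mono)
    then have "(norm (Psi B u s))\<^sup>2 \<le> e * N\<^sup>2"
      using norm_Psi_le[OF B MB, of u s] unfolding N_def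
      by (meson mult_right_mono order_trans zero_le_power2)
    also have "\<dots> = (N * sqrt e)\<^sup>2"
      by (simp add: power_mult_distrib e_def)
    finally show ?thesis
      by (rule power2_le_imp_le) (simp add: N_def e_def)
  qed
  have "(norm (Psi A t s - Psi B t s))\<^sup>2
      \<le> e * ((norm (Psi A s s - Psi B s s))\<^sup>2 + (\<delta> * (N * sqrt e))\<^sup>2 * \<bar>t - s\<bar>)"
    unfolding e_def
  proof (rule gronwall[OF M0], fold e_def)
    fix u
    show "((\<lambda>u. Psi A u s - Psi B u s) has_vector_derivative
        (A u ** Psi A u s - B u ** Psi B u s)) (at u)"
      by (intro has_vector_derivative_diff Psi_has_vector_derivative[OF A] Psi_has_vector_derivative[OF B])
    assume u: "u \<in> closed_segment s t"
    have "A u ** Psi A u s - B u ** Psi B u s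
        = A u ** (Psi A u s - Psi B u s) + (A u - B u) ** Psi B u s"
      by (simp add: matrix_mult.diff_right matrix_mult.diff_left)
    also have "norm \<dots> \<le> norm (A u) * norm (Psi A u s - Psi B u s) + norm (A u - B u) * norm (Psi B u s)"
      by (intro norm_triangle_mono norm_matrix_mult_le)
    also have "\<dots> \<le> M * norm (Psi A u s - Psi B u s) + \<delta> * (N * sqrt e)"
      by (intro add_mono mult_mono MA AB bd u) (use M0 \<delta>0 in auto)
    finally show "norm (A u ** Psi A u s - B u ** Psi B u s)
        \<le> M * norm (Psi A u s - Psi B u s) + \<delta> * (N * sqrt e)" .
  qed
  \<comment> \<open>One \<open>sqrt e\<close> comes from the growth of \<open>Psi B\<close>, the
    other from Gronwall.\<close>
  also have "\<dots> = (\<delta> * (N * sqrt \<bar>t - s\<bar> * e))\<^sup>2"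
    by (simp add: Psi_refl[OF A] Psi_refl[OF B] power_mult_distrib e_def power2_eq_square[of "exp _"])
  finally show ?thesis
    unfolding N_def[symmetric] e_def[symmetric]
    by (rule power2_le_imp_le) (simp add: N_def e_def \<delta>0)
qed

lemma uniform_limit_norm_bound:
  fixes A :: "nat \<Rightarrow> 'b \<Rightarrow> 'a :: real_normed_vector"
  assumes "uniform_limit UNIV A B sequentially" and "\<And>n t. norm (A n t) \<le> M"
  shows "norm (B t) \<le> M"
  using tendsto_norm[OF tendsto_uniform_limitI[OF assms(1), of t]] assms(2)
  by (intro LIMSEQ_le_const2[of "\<lambda>n. norm (A n t)"]) auto

text \<open>The type argument fixes the dimension, on which the norm of the identity depends and
  which occurs nowhere else in the type.\<close>

definition Psi_modulus :: "'p::finite itself \<Rightarrow> real \<Rightarrow> real \<Rightarrow> real" where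
  "Psi_modulus _ M T = norm (mat 1 :: complex ^ 'p ^ 'p) * sqrt T * exp ((2 * M + 1) * T)"

lemma norm_Psi_diff_le_modulus:
  fixes A B :: "real \<Rightarrow> complex ^ 'p ^ 'p"
  assumes A: "fundamental_matrix A X" and B: "fundamental_matrix B Y"
    and MA: "\<And>t. norm (A t) \<le> M" and MB: "\<And>t. norm (B t) \<le> M"
    and AB: "\<And>t. norm (A t - B t) \<le> \<delta>"
    and T: "\<bar>t - s\<bar> \<le> T"
  shows "norm (Psi A t s - Psi B t s) \<le> \<delta> * Psi_modulus TYPE('p) M T"
proof -
  have "M \<ge> 0" using norm_ge_zero[of "A 0"] MA[of 0] by linarith
  moreover have "\<delta> \<ge> 0" using norm_ge_zero[of "A 0 - B 0"] AB[of 0] by linarith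
  ultimately have "\<delta> * (norm (mat 1 :: complex ^ 'p ^ 'p) * sqrt \<bar>t - s\<bar> * exp ((2 * M + 1) * \<bar>t - s\<bar>))
      \<le> \<delta> * Psi_modulus TYPE('p) M T"
    unfolding Psi_modulus_def using T by (intro mult_left_mono mult_mono) auto
  then show ?thesis
    using norm_Psi_diff_le[OF A B MA MB AB, of t s] by linarith
qed

lemma Psi_modulus_tendsto_0: "((\<lambda>s. Psi_modulus TYPE('p::finite) M \<bar>s - a\<bar>) \<longlongrightarrow> 0) (at a)"
proof -
  have "isCont (\<lambda>s. Psi_modulus TYPE('p) M \<bar>s - a\<bar>) a"
    unfolding Psi_modulus_def by (intro continuous_intros)
  then show ?thesis by (simp add: isCont_def Psi_modulus_def)
qed

text \<open>Needed for measurability of the integrands in \<open>s\<close>. Comparison with the zero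
  system, whose transition matrix is \<open>mat 1\<close>, gives continuity on the diagonal; the
  cocycle identity \<open>Psi_comp\<close> carries it to any \<open>t\<close>.\<close>

lemma continuous_Psi:
  fixes A :: "real \<Rightarrow> complex ^ 'p ^ 'p"
  assumes fm: "fundamental_matrix A X" and M: "\<And>t. norm (A t) \<le> M"
  shows "continuous_on UNIV (\<lambda>s. Psi A t s)"
  unfolding continuous_on_def
proof safe
  fix a
  have M0: "M \<ge> 0" using norm_ge_zero[of "A 0"] M[of 0] by linarith
  have zero: "fundamental_matrix (\<lambda>_. 0) (\<lambda>_. mat 1 :: complex ^ 'p ^ 'p)"
    by (auto simp: fundamental_matrix_def invertible_def intro!: derivative_eq_intros exI[of _ "mat 1"])
  have Psi_zero: "Psi (\<lambda>_. 0) t s = (mat 1 :: complex ^ 'p ^ 'p)" for t s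
    by (rule solution_eq_Psi[symmetric, OF zero, of 0]) (auto intro!: derivative_eq_intros)
  have "((\<lambda>s. Psi A a s - mat 1) \<longlongrightarrow> 0) (at a)"
  proof (rule Lim_null_comparison)
    have "norm (Psi A a s - mat 1) \<le> M * Psi_modulus TYPE('p) M \<bar>s - a\<bar>" for s
      using norm_Psi_diff_le_modulus[OF fm zero M, of M a s "\<bar>s - a\<bar>"] M M0
      by (simp add: Psi_zero abs_minus_commute)
    then show "\<forall>\<^sub>F s in at a. norm (Psi A a s - mat 1) \<le> M * Psi_modulus TYPE('p) M \<bar>s - a\<bar>"
      by simp
    show "((\<lambda>s. M * Psi_modulus TYPE('p) M \<bar>s - a\<bar>) \<longlongrightarrow> 0) (at a)"
      using tendsto_mult_right_zero[OF Psi_modulus_tendsto_0] by blast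
  qed
  then have "((\<lambda>s. Psi A a s) \<longlongrightarrow> mat 1) (at a)" by (rule LIM_zero_cancel)
  then have "((\<lambda>s. Psi A t a ** Psi A a s) \<longlongrightarrow> Psi A t a ** mat 1) (at a)"
    by (intro matrix_mult.tendsto tendsto_const)
  then show "((\<lambda>s. Psi A t s) \<longlongrightarrow> Psi A t a) (at a within UNIV)"
    by (simp add: Psi_comp[OF fm])
qed

text \<open>The point is that \<open>\<delta>\<close> does not depend on the two systems, so one
  choice serves a whole sequence.\<close>

lemma Psi_close:
  fixes M T e :: real
  assumes "e > 0"
  obtains \<delta> where "\<delta> > 0"
    and "\<And>(A :: real \<Rightarrow> complex ^ 'p ^ 'p) B X Y t s.
      \<lbrakk>fundamental_matrix A X; fundamental_matrix B Y; \<And>t. norm (A t) \<le> M; \<And>t. norm (B t) \<le> M;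
       \<And>t. dist (A t) (B t) < \<delta>; \<bar>t - s\<bar> \<le> T\<rbrakk> \<Longrightarrow> dist (Psi A t s) (Psi B t s) < e"
proof -
  define C where "C = Psi_modulus TYPE('p) M T"
  \<comment> \<open>Since \<open>M\<close> and \<open>T\<close> are arbitrary, \<open>C\<close> may
    be zero or negative.\<close>
  define \<delta> where "\<delta> = e / (\<bar>C\<bar> + 1)"
  have \<delta>: "\<delta> > 0" using \<open>e > 0\<close> by (simp add: \<delta>_def add_nonneg_pos)
  show thesis
  proof (rule that[OF \<delta>])
    fix A B X Y :: "real \<Rightarrow> complex ^ 'p ^ 'p" and t s :: real
    assume *: "fundamental_matrix A X" "fundamental_matrix B Y"
      "\<And>t. norm (A t) \<le> M" "\<And>t. norm (B t) \<le> M" "\<And>t. dist (A t) (B t) < \<delta>" "\<bar>t - s\<bar> \<le> T"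
    have "dist (Psi A t s) (Psi B t s) \<le> \<delta> * C"
      unfolding C_def dist_norm using *(5,6)
      by (intro norm_Psi_diff_le_modulus[OF *(1-4)]) (auto simp: dist_norm intro: less_imp_le)
    also have "\<dots> \<le> \<delta> * \<bar>C\<bar>" using \<delta> by (intro mult_left_mono) auto
    also have "\<dots> < \<delta> * (\<bar>C\<bar> + 1)" using \<delta> by simp
    also have "\<dots> = e" by (simp add: \<delta>_def add_nonneg_eq_0_iff)
    finally show "dist (Psi A t s) (Psi B t s) < e" .
  qed
qed

text \<open>Stated as a Cauchy property because \<open>B\<close> is not yet known to have a
  fundamental matrix, so \<open>Psi B\<close> cannot serve as the limit.\<close>

lemma Psi_uniformly_Cauchy:
  fixes A :: "nat \<Rightarrow> real \<Rightarrow> complex ^ 'p ^ 'p"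
  assumes fm: "\<And>n. fundamental_matrix (A n) (X n)" and M: "\<And>n t. norm (A n t) \<le> M"
    and ul: "uniform_limit UNIV A B sequentially"
  shows "uniformly_Cauchy_on {(t, s). \<bar>t - s\<bar> \<le> T} (\<lambda>n (t, s). Psi (A n) t s)"
proof (rule uniformly_Cauchy_onI)
  fix e :: real assume "e > 0"
  obtain \<delta> where \<delta>: "\<delta> > 0" "\<And>m n t s. (\<And>t. dist (A m t) (A n t) < \<delta>) \<Longrightarrow> \<bar>t - s\<bar> \<le> T
      \<Longrightarrow> dist (Psi (A m) t s) (Psi (A n) t s) < e"
  proof (rule Psi_close[where 'p = 'p, OF \<open>e > 0\<close>, of M T], goal_cases)
    case (1 \<delta>)
    show ?case by (rule 1(1)[OF 1(2) 1(3)[OF fm fm M M]])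
  qed
  have "uniformly_Cauchy_on UNIV A"
    using ul by (auto simp: uniformly_convergent_eq_Cauchy[symmetric] uniformly_convergent_on_def)
  then obtain N where "\<And>t m n. m \<ge> N \<Longrightarrow> n \<ge> N \<Longrightarrow> dist (A m t) (A n t) < \<delta>"
    using \<delta>(1) unfolding uniformly_Cauchy_on_def by (metis UNIV_I)
  then show "\<exists>N. \<forall>x\<in>{(t, s). \<bar>t - s\<bar> \<le> T}. \<forall>m\<ge>N. \<forall>n\<ge>N.
      dist (case x of (t, s) \<Rightarrow> Psi (A m) t s) (case x of (t, s) \<Rightarrow> Psi (A n) t s) < e"
    by (intro exI[of _ N]) (auto intro: \<delta>(2))
qed

text \<open>The limit system obtains its fundamental matrix as the limit of the matrices \<open>\<Psi>(t, 0)\<close> of the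
  approximating systems; the limit of \<open>\<Psi>(0, t)\<close> is its inverse. This avoids
  an existence theorem for linear systems.\<close>

lemma fundamental_matrix_limit:
  fixes A :: "nat \<Rightarrow> real \<Rightarrow> complex ^ 'p ^ 'p"
  assumes fm: "\<And>n. fundamental_matrix (A n) (X n)" and M: "\<And>n t. norm (A n t) \<le> M"
    and ul: "uniform_limit UNIV A B sequentially"
  obtains Z where "fundamental_matrix B Z"
proof -
  define L where "L t s = lim (\<lambda>n. Psi (A n) t s)" for t s
  have L: "(\<lambda>n. Psi (A n) t s) \<longlonglongrightarrow> L t s" for t s
  proof -
    have "Cauchy (\<lambda>n. Psi (A n) t s)"
      using uniformly_Cauchy_imp_Cauchy[OF Psi_uniformly_Cauchy[OF fm M ul, of "\<bar>t - s\<bar>"], of "(t, s)"]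
      by simp
    then show ?thesis
      unfolding L_def by (simp add: Cauchy_convergent convergent_LIMSEQ_iff[symmetric])
  qed
  have ulL: "uniform_limit {-T..T} (\<lambda>n t. Psi (A n) t 0) (\<lambda>t. L t 0) sequentially" for T
  proof -
    have "uniformly_Cauchy_on {-T..T} (\<lambda>n t. Psi (A n) t 0)"
      using Psi_uniformly_Cauchy[OF fm M ul, of T] unfolding uniformly_Cauchy_on_def
      by (force simp: abs_le_iff)
    then obtain l where l: "uniform_limit {-T..T} (\<lambda>n t. Psi (A n) t 0) l sequentially"
      by (auto simp: uniformly_convergent_eq_Cauchy[symmetric] uniformly_convergent_on_def)
    have "l t = L t 0" if "t \<in> {-T..T}" for t
      using LIMSEQ_unique[OF tendsto_uniform_limitI[OF l that] L] .
    then have "uniform_limit {-T..T} (\<lambda>n t. Psi (A n) t 0) l sequentially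
        \<longleftrightarrow> uniform_limit {-T..T} (\<lambda>n t. Psi (A n) t 0) (\<lambda>t. L t 0) sequentially"
      by (intro uniform_limit_cong') auto
    with l show ?thesis by blast
  qed
  have inv: "L t s ** L s t = mat 1" for t s
  proof -
    have "(\<lambda>n. Psi (A n) t s ** Psi (A n) s t) \<longlonglongrightarrow> L t s ** L s t"
      by (intro matrix_mult.tendsto L)
    then show ?thesis
      by (simp add: Psi_comp[OF fm] Psi_refl[OF fm] LIMSEQ_const_iff)
  qed
  have der: "((\<lambda>t. L t 0) has_vector_derivative B t ** L t 0) (at t)" for t
  proof -
    \<comment> \<open>The window contains \<open>0\<close>, where convergence of the values is
      supplied to \<open>has_derivative_sequence\<close>, and has \<open>t\<close> in its interior,
      so that the derivative within \<open>S\<close> is the full one.\<close>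
    define S where "S = {- (\<bar>t\<bar> + 1)..\<bar>t\<bar> + 1}"
    \<comment> \<open>Products of uniformly convergent sequences converge uniformly once both limits
      are bounded.\<close>
    have "bounded ((\<lambda>t. L t 0) ` S)"
    proof (intro compact_imp_bounded compact_continuous_image)
      show "continuous_on S (\<lambda>t. L t 0)"
      proof (rule uniform_limit_theorem[OF _ ulL[of "\<bar>t\<bar> + 1", folded S_def]])
        show "\<forall>\<^sub>F n in sequentially. continuous_on S (\<lambda>t. Psi (A n) t 0)"
          using Psi_has_vector_derivative[OF fm]
          by (auto intro!: always_eventually continuous_at_imp_continuous_on
              has_vector_derivative_continuous)
      qed simp
    qed (simp add: S_def)
    moreover have "bounded (B ` S)"
      using uniform_limit_norm_bound[OF ul M] by (auto intro: boundedI)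
    ultimately have ulAP: "uniform_limit S (\<lambda>n t. A n t ** Psi (A n) t 0) (\<lambda>t. B t ** L t 0) sequentially"
      using ul ulL[of "\<bar>t\<bar> + 1", folded S_def]
      by (intro matrix_mult.bounded_uniform_limit) (auto intro: uniform_limit_on_subset)
    \<comment> \<open>Termwise differentiation yields a limit \<open>g\<close> of its own,
      identified with \<open>L\<close> afterwards.\<close>
    have "\<exists>g. \<forall>x\<in>S. (\<lambda>n. Psi (A n) x 0) \<longlonglongrightarrow> g x \<and>
        (g has_derivative (\<lambda>h. h *\<^sub>R (B x ** L x 0))) (at x within S)"
    proof (rule has_derivative_sequence)
      show "convex S" by (simp add: S_def)
      show "((\<lambda>t. Psi (A n) t 0) has_derivative (\<lambda>h. h *\<^sub>R (A n x ** Psi (A n) x 0))) (at x within S)" for n x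
        using Psi_has_vector_derivative[OF fm]
        by (simp add: has_vector_derivative_def has_derivative_at_withinI)
      show "0 \<in> S" by (simp add: S_def)
      show "(\<lambda>n. Psi (A n) 0 0) \<longlonglongrightarrow> L 0 0" by (rule L)
      fix e :: real assume "e > 0"
      from uniform_limitD[OF ulAP this]
      show "\<forall>\<^sub>F n in sequentially. \<forall>x\<in>S. \<forall>h.
          norm (h *\<^sub>R (A n x ** Psi (A n) x 0) - h *\<^sub>R (B x ** L x 0)) \<le> e * norm h"
        by eventually_elim
          (auto simp: dist_norm scaleR_diff_right[symmetric] mult.commute[of e]
            intro!: mult_left_mono intro: less_imp_le)
    qed
    then obtain g where g: "\<And>x. x \<in> S \<Longrightarrow> (\<lambda>n. Psi (A n) x 0) \<longlonglongrightarrow> g x"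
        "\<And>x. x \<in> S \<Longrightarrow> (g has_vector_derivative B x ** L x 0) (at x within S)"
      unfolding has_vector_derivative_def by blast
    have gL: "g x = L x 0" if "x \<in> S" for x
      using LIMSEQ_unique[OF g(1)[OF that] L] .
    have "t \<in> interior S" by (auto simp: S_def)
    then have t: "t \<in> S" "at t within S = at t"
      using interior_subset[of S] by (auto intro: at_within_interior)
    have "((\<lambda>t. L t 0) has_vector_derivative B t ** L t 0) (at t within S)"
      by (rule has_vector_derivative_transform[OF t(1) _ g(2)[OF t(1)]]) (simp add: gL)
    then show ?thesis by (simp add: t(2))
  qed
  have "fundamental_matrix B (\<lambda>t. L t 0)"
    unfolding fundamental_matrix_def invertible_def using der inv by blast
  then show thesis by (rule that)
qed

lemma Psi_tendsto:
  fixes A :: "nat \<Rightarrow> real \<Rightarrow> complex ^ 'p ^ 'p"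
  assumes fmA: "\<And>n. fundamental_matrix (A n) (X n)" and fmB: "fundamental_matrix B Y"
    and M: "\<And>n t. norm (A n t) \<le> M"
    and ul: "uniform_limit UNIV A B sequentially"
  shows "(\<lambda>n. Psi (A n) t s) \<longlonglongrightarrow> Psi B t s"
proof (rule tendstoI)
  fix e :: real assume "e > 0"
  obtain \<delta> where \<delta>: "\<delta> > 0" "\<And>n. (\<And>t. dist (A n t) (B t) < \<delta>) \<Longrightarrow> dist (Psi (A n) t s) (Psi B t s) < e"
  proof (rule Psi_close[where 'p = 'p, OF \<open>e > 0\<close>, of M "\<bar>t - s\<bar>"], goal_cases)
    case (1 \<delta>)
    show ?case
      by (rule 1(1)[OF 1(2) 1(3)[OF fmA fmB M uniform_limit_norm_bound[OF ul M] _ order_refl]])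
  qed
  from uniform_limitD[OF ul \<delta>(1)]
  show "\<forall>\<^sub>F n in sequentially. dist (Psi (A n) t s) (Psi B t s) < e"
    by eventually_elim (auto intro: \<delta>(2))
qed

subsection \<open>Almost periodic functions\<close>

text \<open>Halving the radius leaves room for the closure: finitely many closed balls of radius
  \<open>e / 2\<close> have a closed union, which lies in the open balls of radius
  \<open>e\<close>.\<close>

lemma compact_closure_if_totally_bounded:
  fixes S :: "'a :: complete_space set"
  assumes "\<And>e. e > 0 \<Longrightarrow> \<exists>k. finite k \<and> S \<subseteq> (\<Union>x\<in>k. ball x e)"
  shows "compact (closure S)"
  unfolding compact_eq_totally_bounded
proof (intro conjI allI impI)
  show "complete (closure S)" by (simp add: complete_eq_closed)
  fix e :: real assume "e > 0"
  then obtain k where k: "finite k" "S \<subseteq> (\<Union>x\<in>k. ball x (e / 2))"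
    using assms[of "e / 2"] by auto
  have "closure S \<subseteq> (\<Union>x\<in>k. cball x (e / 2))"
  proof (rule closure_minimal)
    show "S \<subseteq> (\<Union>x\<in>k. cball x (e / 2))"
      using k(2) ball_subset_cball by (meson UN_mono order_refl order_trans)
  qed (use k(1) in \<open>simp add: closed_UN\<close>)
  also have "\<dots> \<subseteq> (\<Union>x\<in>k. ball x e)"
    using \<open>e > 0\<close> by (intro UN_mono) auto
  finally show "\<exists>k. finite k \<and> closure S \<subseteq> (\<Union>x\<in>k. ball x e)"
    using k(1) by blast
qed

lemma
  assumes "almost_periodic A"
  shows almost_periodic_bounded: "bounded (range A)"
    and almost_periodic_continuous: "continuous_on S A"
  using assms continuous_on_subset unfolding almost_periodic_def by blast+

lemma almost_periodicE:
  assumes "almost_periodic A" "e > 0"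
  obtains l where "l > 0" "\<And>a. \<exists>\<xi>\<in>{a..a + l}. \<forall>t. norm (A (t + \<xi>) - A t) \<le> e"
  using assms unfolding almost_periodic_def by blast

text \<open>An almost period moves \<open>x\<close> into the compact window \<open>{0..l}\<close>
  and changes \<open>A\<close> little at both points, so uniform continuity near the window
  suffices.\<close>

lemma almost_periodic_uniformly_continuous:
  assumes ap: "almost_periodic A"
  shows "uniformly_continuous_on UNIV A"
  unfolding uniformly_continuous_on_def
proof (intro allI impI)
  fix e :: real assume "e > 0"
  then obtain l where l: "l > 0" "\<And>a. \<exists>\<xi>\<in>{a..a + l}. \<forall>t. norm (A (t + \<xi>) - A t) \<le> e / 4"
    using almost_periodicE[OF ap, of "e / 4"] by auto
  \<comment> \<open>The margin of 1 on each side keeps the translate of \<open>y\<close> in the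
    window when \<open>y\<close> is within 1 of \<open>x\<close>; hence \<open>min d 1\<close>
    below.\<close>
  have "uniformly_continuous_on {-1..l + 1} A"
    by (intro compact_uniformly_continuous almost_periodic_continuous[OF ap]) simp
  then obtain d where d: "d > 0"
      "\<And>x y. x \<in> {-1..l + 1} \<Longrightarrow> y \<in> {-1..l + 1} \<Longrightarrow> dist y x < d \<Longrightarrow> dist (A y) (A x) < e / 4"
    using \<open>e > 0\<close> unfolding uniformly_continuous_on_def by (metis divide_pos_pos zero_less_numeral)
  have "dist (A y) (A x) < e" if "dist y x < min d 1" for x y
  proof -
    obtain \<xi> where \<xi>: "\<xi> \<in> {- x..- x + l}" "\<And>t. norm (A (t + \<xi>) - A t) \<le> e / 4"
      using l(2)[of "- x"] by blast
    have "dist (A (y + \<xi>)) (A (x + \<xi>)) < e / 4"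
      by (rule d(2)) (use \<xi>(1) that in \<open>auto simp: dist_real_def\<close>)
    moreover have "dist (A y) (A (y + \<xi>)) \<le> e / 4" "dist (A (x + \<xi>)) (A x) \<le> e / 4"
      using \<xi>(2) by (simp_all add: dist_norm norm_minus_commute)
    ultimately show ?thesis
      using dist_triangle[of "A y" "A x" "A (y + \<xi>)"]
        dist_triangle[of "A (y + \<xi>)" "A x" "A (x + \<xi>)"] \<open>e > 0\<close> by linarith
  qed
  then show "\<exists>d>0. \<forall>x\<in>UNIV. \<forall>y\<in>UNIV. dist y x < d \<longrightarrow> dist (A y) (A x) < e"
    using d(1) by (intro exI[of _ "min d 1"]) auto
qed

text \<open>A translate \<open>A\<^sub>\<xi>\<close> differs by at most \<open>\<epsilon>\<close> from some \<open>A\<^sub>r\<close> with \<open>r\<close> in \<open>[0, l\<^sub>\<epsilon>]\<close>, and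
  \<open>r \<mapsto> A\<^sub>r\<close> is uniformly continuous: hence the translates form a totally bounded set.\<close>

lemma almost_periodic_uniform_subseq:
  fixes \<xi> :: "nat \<Rightarrow> real"
  assumes ap: "almost_periodic A"
  obtains r B where "strict_mono r" "uniform_limit UNIV (\<lambda>n. shift A (\<xi> (r n))) B sequentially"
proof -
  \<comment> \<open>Among bounded continuous functions the metric is the supremum distance, so
    convergence there is uniform convergence.\<close>
  define T where "T x = Bcontfun (shift A x)" for x
  have "shift A x \<in> bcontfun" for x
  proof -
    have "bounded (range (shift A x))"
      by (rule bounded_subset[OF almost_periodic_bounded[OF ap]]) (auto simp: shift_def)
    moreover have "continuous_on UNIV (shift A x)"
      unfolding shift_def
      by (intro continuous_on_compose2[OF almost_periodic_continuous[OF ap]] continuous_intros) auto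
    ultimately show ?thesis by (simp add: bcontfun_def)
  qed
  then have T: "apply_bcontfun (T x) = shift A x" for x
    by (simp add: T_def Bcontfun_inverse)
  have "compact (closure (range T))"
  proof (rule compact_closure_if_totally_bounded)
    fix e :: real assume "e > 0"
    then obtain l where l: "l > 0" "\<And>a. \<exists>\<xi>\<in>{a..a + l}. \<forall>t. norm (A (t + \<xi>) - A t) \<le> e / 4"
      using almost_periodicE[OF ap, of "e / 4"] by auto
    obtain d where d: "d > 0" "\<And>x y. dist y x < d \<Longrightarrow> dist (A y) (A x) < e / 4"
      using almost_periodic_uniformly_continuous[OF ap] \<open>e > 0\<close>
      unfolding uniformly_continuous_on_def by (metis UNIV_I divide_pos_pos zero_less_numeral)
    obtain k where k: "finite k" "{0..l} \<subseteq> (\<Union>x\<in>k. ball x d)"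
      using compact_Icc[of 0 l] d(1) unfolding compact_eq_totally_bounded by blast
    have "\<exists>x\<in>k. T y \<in> ball (T x) e" for y
    proof -
      obtain \<tau> where \<tau>: "\<tau> \<in> {y - l..y}" "\<And>t. norm (A (t + \<tau>) - A t) \<le> e / 4"
        using l(2)[of "y - l"] by auto
      have "y - \<tau> \<in> {0..l}"
        using \<tau>(1) by simp
      then obtain x where x: "x \<in> k" "dist x (y - \<tau>) < d"
        using k(2) by (meson UN_E mem_ball subsetD)
      have "dist (T x) (T y) \<le> e / 2"
      proof (rule dist_bound)
        fix t
        have "dist (A (t + x)) (A (t + (y - \<tau>))) < e / 4"
          by (rule d(2)) (use x(2) in \<open>simp add: dist_real_def\<close>)
        moreover have "dist (A (t + (y - \<tau>))) (A (t + y)) \<le> e / 4"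
          using \<tau>(2)[of "t + (y - \<tau>)"] by (simp add: dist_norm norm_minus_commute)
        ultimately show "dist (apply_bcontfun (T x) t) (apply_bcontfun (T y) t) \<le> e / 2"
          using dist_triangle[of "A (t + x)" "A (t + y)" "A (t + (y - \<tau>))"]
          unfolding T shift_def by linarith
      qed
      then show ?thesis using x(1) \<open>e > 0\<close> by (intro bexI[of _ x]) auto
    qed
    then show "\<exists>k. finite k \<and> range T \<subseteq> (\<Union>x\<in>k. ball x e)"
      using k(1) by (intro exI[of _ "T ` k"]) auto
  qed
  moreover have "T (\<xi> n) \<in> closure (range T)" for n
    using closure_subset[of "range T"] by blast
  ultimately obtain b r where r: "strict_mono r" and "((\<lambda>n. T (\<xi> n)) \<circ> r) \<longlonglongrightarrow> b"
    unfolding compact_def by metis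
  then have "uniform_limit UNIV (\<lambda>n. apply_bcontfun (T (\<xi> (r n)))) b sequentially"
    by (intro tendsto_bcontfun_uniform_limit) (simp add: comp_def)
  then show ?thesis by (intro that[OF r]) (simp add: T)
qed

section \<open>Pointwise and uniform convergence of translates\<close>

lemma uniform_limit_shift_back:
  assumes "uniform_limit UNIV (\<lambda>n. shift A (\<xi> n)) B sequentially"
  shows "uniform_limit UNIV (\<lambda>n. shift B (- \<xi> n)) A sequentially"
proof (rule uniform_limitI)
  fix e :: real assume "e > 0"
  from uniform_limitD[OF assms this]
  show "\<forall>\<^sub>F n in sequentially. \<forall>t\<in>UNIV. dist (shift B (- \<xi> n) t) (A t) < e"
  proof eventually_elim
    case (elim n)
    show ?case
    proof
      fix t
      \<comment> \<open>Uniformity permits evaluation at the moving point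
        \<open>t - \<xi> n\<close>.\<close>
      show "dist (shift B (- \<xi> n) t) (A t) < e"
        using elim[THEN bspec, of "t - \<xi> n"] by (simp add: shift_def dist_commute)
    qed
  qed
qed

lemma uniform_limit_imp_aa_limit:
  assumes "uniform_limit UNIV (\<lambda>n. shift A (\<xi> n)) B sequentially"
  shows "aa_limit A \<xi> B"
  unfolding aa_limit_def
  using tendsto_uniform_limitI[OF assms] tendsto_uniform_limitI[OF uniform_limit_shift_back[OF assms]]
  by (simp add: shift_def)

lemma almost_periodic_imp_almost_automorphic:
  assumes "almost_periodic A"
  shows "almost_automorphic A"
  unfolding almost_automorphic_def
proof
  fix \<xi> :: "nat \<Rightarrow> real"
  show "\<exists>r B. strict_mono r \<and> aa_limit A (\<xi> \<circ> r) B"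
    by (rule almost_periodic_uniform_subseq[OF assms, of \<xi>])
      (auto intro!: exI uniform_limit_imp_aa_limit simp: comp_def)
qed

text \<open>If uniform closeness failed infinitely often, those indices would form a subsequence. A
  further subsequence converges uniformly by \<open>almost_periodic_uniform_subseq\<close>, and
  uniqueness of pointwise limits makes its limit \<open>B\<close>, a contradiction.\<close>

lemma aa_limit_imp_uniform_limit:
  assumes ap: "almost_periodic A" and aa: "aa_limit A \<xi> B"
  shows "uniform_limit UNIV (\<lambda>n. shift A (\<xi> n)) B sequentially"
proof (rule uniform_limitI, rule ccontr)
  fix e :: real assume "e > 0"
  define Q where "Q n \<longleftrightarrow> (\<forall>t\<in>UNIV. dist (shift A (\<xi> n) t) (B t) < e)" for n
  assume "\<not> (\<forall>\<^sub>F n in sequentially. \<forall>t\<in>UNIV. dist (shift A (\<xi> n) t) (B t) < e)"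
  then have "infinite {n. \<not> Q n}"
    by (simp add: Q_def cofinite_eq_sequentially[symmetric] eventually_cofinite)
  then obtain q :: "nat \<Rightarrow> nat" where q: "strict_mono q" "\<And>n. \<not> Q (q n)"
    using infinite_enumerate[of "{n. \<not> Q n}"] by auto
  obtain r B' where r: "strict_mono r"
      "uniform_limit UNIV (\<lambda>n. shift A (\<xi> (q (r n)))) B' sequentially"
    using almost_periodic_uniform_subseq[OF ap, of "\<xi> \<circ> q"] by (auto simp: comp_def)
  have "B' = B"
  proof
    fix t
    have "(\<lambda>n. A (t + \<xi> (q (r n)))) \<longlonglongrightarrow> B' t"
      using tendsto_uniform_limitI[OF r(2), of t] by (simp add: shift_def)
    moreover have "(\<lambda>n. A (t + \<xi> (q (r n)))) \<longlonglongrightarrow> B t"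
      using LIMSEQ_subseq_LIMSEQ[of "\<lambda>n. A (t + \<xi> n)" "B t" "q \<circ> r"] 
        strict_mono_o[OF q(1) r(1)] aa
      by (simp add: aa_limit_def comp_def)
    ultimately show "B' t = B t" by (rule LIMSEQ_unique)
  qed
  then have "\<forall>\<^sub>F n in sequentially. Q (q (r n))"
    using uniform_limitD[OF r(2) \<open>e > 0\<close>] by (simp add: Q_def)
  with q(2) show False by simp
qed

subsection \<open>Convergence of the integrals\<close>

text \<open>After translation by \<open>t\<close> the integral is split at the origin; reflection
  shows that both halves equal the same finite integral \<open>I\<close>.\<close>

lemma nn_integral_exp_minus_abs_finite:
  fixes t \<alpha> :: real
  assumes "\<alpha> > 0"
  shows "(\<integral>\<^sup>+ s. ennreal (exp (- \<alpha> * \<bar>t - s\<bar>)) \<partial>lborel) < \<infinity>"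
proof -
  define I where "I = (\<integral>\<^sup>+ x. ennreal (exp (- \<alpha> * x)) * indicator {0..} x \<partial>lborel)"
  have I: "I < \<infinity>"
    unfolding I_def
    using nn_integral_has_integral_lebesgue'[OF _ has_integral_exp_minus_to_infinity[OF assms, of 0]]
    by simp
  have "I = (\<integral>\<^sup>+ x. ennreal (exp (- \<alpha> * (0 + (-1) * x))) * indicator {0..} (0 + (-1) * x :: real) \<partial>lborel)"
    unfolding I_def by (subst nn_integral_real_affine[of _ "-1" 0]) simp_all
  then have I': "I = (\<integral>\<^sup>+ x. ennreal (exp (- \<alpha> * (- x))) * indicator {..0} x \<partial>lborel)"
    by (simp add: indicator_def)
  have "(\<integral>\<^sup>+ s. ennreal (exp (- \<alpha> * \<bar>t - s\<bar>)) \<partial>lborel) = (\<integral>\<^sup>+ x. ennreal (exp (- \<alpha> * \<bar>x\<bar>)) \<partial>lborel)"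
    by (subst nn_integral_real_affine[of _ 1 t]) simp_all
  also have "\<dots> \<le> (\<integral>\<^sup>+ x. ennreal (exp (- \<alpha> * x)) * indicator {0..} x
      + ennreal (exp (- \<alpha> * (- x))) * indicator {..0} x \<partial>lborel)"
    by (intro nn_integral_mono) (auto simp: indicator_def)
  also have "\<dots> = I + I"
    using I' by (simp add: nn_integral_add I_def)
  also have "\<dots> < \<infinity>" using I by simp
  finally show ?thesis .
qed

text \<open>A general Borel set \<open>S\<close> and a general sequence of systems let one dominated
  convergence argument cover both half-lines and both limits.\<close>

lemma nn_integral_Psi_diff_tendsto_0:
  fixes A :: "nat \<Rightarrow> real \<Rightarrow> complex ^ 'p ^ 'p" and P :: "complex ^ 'p ^ 'p"
  assumes fmA: "\<And>n. fundamental_matrix (A n) (X n)" and fmB: "fundamental_matrix B Y"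
    and M: "\<And>n t. norm (A n t) \<le> M"
    and ul: "uniform_limit UNIV A B sequentially"
    and S: "S \<in> sets borel" and "c > 0" "\<alpha> > 0"
    and bdA: "\<And>n s. s \<in> S \<Longrightarrow> s \<noteq> t \<Longrightarrow> norm (Psi (A n) t s ** P) \<le> c * exp (- \<alpha> * \<bar>t - s\<bar>)"
  shows "(\<lambda>n. \<integral>\<^sup>+ s\<in>S. ennreal (norm ((Psi (A n) t s - Psi B t s) ** P)) \<partial>lborel) \<longlonglongrightarrow> 0"
proof -
  define w where "w s = 2 * c * exp (- \<alpha> * \<bar>t - s\<bar>)" for s
  have lim: "(\<lambda>n. Psi (A n) t s) \<longlonglongrightarrow> Psi B t s" for s
    by (rule Psi_tendsto[OF fmA fmB M ul])
  have bd: "norm ((Psi (A n) t s - Psi B t s) ** P) \<le> w s" if "s \<in> S" for n s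
  \<comment> \<open>At \<open>s = t\<close> no exponential bound is assumed, but both transition
    matrices are the identity there.\<close>
  proof (cases "s = t")
    case True
    then show ?thesis
      using \<open>c > 0\<close> by (simp add: Psi_refl[OF fmA] Psi_refl[OF fmB] matrix_mult.zero_left w_def)
  next
    case False
    \<comment> \<open>The bound for \<open>Psi B\<close> is inherited as a pointwise limit; adding
      it to that for \<open>Psi (A n)\<close> explains the factor 2 in \<open>w\<close>.\<close>
    have "(\<lambda>n. norm (Psi (A n) t s ** P)) \<longlonglongrightarrow> norm (Psi B t s ** P)"
      by (intro tendsto_norm matrix_mult.tendsto lim tendsto_const)
    then have "norm (Psi B t s ** P) \<le> c * exp (- \<alpha> * \<bar>t - s\<bar>)"
      by (rule LIMSEQ_le_const2) (use bdA[OF that False] in blast)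
    then show ?thesis
      using bdA[OF that False, of n] norm_triangle_ineq4[of "Psi (A n) t s ** P" "Psi B t s ** P"]
      by (simp add: matrix_mult.diff_left w_def)
  qed
  have "(\<lambda>n. \<integral>\<^sup>+ s. ennreal (norm ((Psi (A n) t s - Psi B t s) ** P)) * indicator S s \<partial>lborel)
      \<longlonglongrightarrow> integral\<^sup>N (lborel :: real measure) (\<lambda>_. 0)"
  proof (rule nn_integral_dominated_convergence[where w = "\<lambda>s. ennreal (w s)"])
    have "continuous_on UNIV (\<lambda>s. norm ((Psi (A n) t s - Psi B t s) ** P))" for n
      by (intro continuous_intros matrix_mult.continuous_on continuous_Psi[OF fmA M]
          continuous_Psi[OF fmB uniform_limit_norm_bound[OF ul M]])
    then have "(\<lambda>s. norm ((Psi (A n) t s - Psi B t s) ** P)) \<in> borel_measurable borel" for n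
      by (rule borel_measurable_continuous_onI)
    then show "(\<lambda>s. ennreal (norm ((Psi (A n) t s - Psi B t s) ** P)) * indicator S s)
        \<in> borel_measurable lborel" for n
      using S by measurable
    show "(\<lambda>s. ennreal (w s)) \<in> borel_measurable lborel"
      unfolding w_def by measurable
    show "AE s in lborel. ennreal (norm ((Psi (A n) t s - Psi B t s) ** P)) * indicator S s \<le> ennreal (w s)" for n
      using bd by (auto simp: indicator_def intro!: always_eventually ennreal_leI)
    have "(\<integral>\<^sup>+ s. ennreal (w s) \<partial>lborel) = ennreal (2 * c) * (\<integral>\<^sup>+ s. ennreal (exp (- \<alpha> * \<bar>t - s\<bar>)) \<partial>lborel)"
      using \<open>c > 0\<close> unfolding w_def by (subst nn_integral_cmult[symmetric]) (auto simp: ennreal_mult)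
    also have "\<dots> < \<infinity>"
      using nn_integral_exp_minus_abs_finite[OF \<open>\<alpha> > 0\<close>, of t] by (simp add: ennreal_mult_less_top)
    finally show "(\<integral>\<^sup>+ s. ennreal (w s) \<partial>lborel) < \<infinity>" .
    have "(\<lambda>n. norm ((Psi (A n) t s - Psi B t s) ** P)) \<longlonglongrightarrow> norm ((Psi B t s - Psi B t s) ** P)" for s
      by (intro tendsto_norm matrix_mult.tendsto tendsto_diff lim tendsto_const)
    then have "(\<lambda>n. ennreal (norm ((Psi (A n) t s - Psi B t s) ** P))) \<longlonglongrightarrow> ennreal 0" for s
      by (intro tendsto_ennrealI) (simp add: matrix_mult.zero_left)
    then show "AE s in lborel. (\<lambda>n. ennreal (norm ((Psi (A n) t s - Psi B t s) ** P)) * indicator S s) \<longlonglongrightarrow> 0"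
      by (auto simp: indicator_def intro!: always_eventually)
  qed simp
  then show ?thesis by simp
qed

text \<open>\<open>R\<close> stands for \<open>t > s\<close> or \<open>t < s\<close>. Its
  translation invariance transfers the bound through \<open>Psi_shift\<close> to the translates of
  \<open>A\<close>, then by limits to \<open>B\<close>, and then to the translates of
  \<open>B\<close>. The second limit follows like the first, as these last translates converge
  uniformly to \<open>A\<close>.\<close>

lemma nn_integral_Psi_shift_tendsto_0:
  fixes A B :: "real \<Rightarrow> complex ^ 'p ^ 'p" and P :: "complex ^ 'p ^ 'p"
  assumes ap: "almost_periodic A" and fm: "fundamental_matrix A \<Phi>"
    and "c > 0" "\<alpha> > 0" and aa: "aa_limit A \<xi> B"
    and R: "\<And>t s h :: real. R t s \<Longrightarrow> R (t + h) (s + h)"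
    and bd: "\<And>t s. R t s \<Longrightarrow> norm (Psi A t s ** P) \<le> c * exp (- \<alpha> * \<bar>t - s\<bar>)"
    and S: "S \<in> sets borel" "\<And>s. s \<in> S \<Longrightarrow> s \<noteq> t \<Longrightarrow> R t s"
  shows "(\<lambda>n. \<integral>\<^sup>+ s\<in>S. ennreal (norm ((Psi (shift A (\<xi> n)) t s - Psi B t s) ** P)) \<partial>lborel) \<longlonglongrightarrow> 0"
    and "(\<lambda>n. \<integral>\<^sup>+ s\<in>S. ennreal (norm ((Psi (shift B (- \<xi> n)) t s - Psi A t s) ** P)) \<partial>lborel) \<longlonglongrightarrow> 0"
proof -
  have ul: "uniform_limit UNIV (\<lambda>n. shift A (\<xi> n)) B sequentially"
    by (rule aa_limit_imp_uniform_limit[OF ap aa])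
  obtain M where MA: "\<And>t. norm (A t) \<le> M"
    using almost_periodic_bounded[OF ap] by (auto simp: bounded_iff)
  then have MAn: "norm (shift A (\<xi> n) t) \<le> M" for n t by (simp add: shift_def)
  have MB: "norm (B t) \<le> M" for t
    by (rule uniform_limit_norm_bound[OF ul MAn])
  then have MBn: "norm (shift B (- \<xi> n) t) \<le> M" for n t by (simp add: shift_def)
  note fmA = fundamental_matrix_shift[OF fm]
  obtain Y where fmB: "fundamental_matrix B Y"
    using fundamental_matrix_limit[OF fmA MAn ul] .
  have bdA: "norm (Psi (shift A (\<xi> n)) t s ** P) \<le> c * exp (- \<alpha> * \<bar>t - s\<bar>)" if "R t s" for n t s
    using bd[OF R[OF that, of "\<xi> n"]] by (simp add: Psi_shift[OF fm MA])
  have bdB: "norm (Psi B t s ** P) \<le> c * exp (- \<alpha> * \<bar>t - s\<bar>)" if "R t s" for t s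
  proof (rule LIMSEQ_le_const2)
    show "(\<lambda>n. norm (Psi (shift A (\<xi> n)) t s ** P)) \<longlonglongrightarrow> norm (Psi B t s ** P)"
      by (intro tendsto_norm matrix_mult.tendsto Psi_tendsto[OF fmA fmB MAn ul] tendsto_const)
  qed (use bdA[OF that] in blast)
  have bdB': "norm (Psi (shift B (- \<xi> n)) t s ** P) \<le> c * exp (- \<alpha> * \<bar>t - s\<bar>)" if "R t s" for n t s
    using bdB[OF R[OF that, of "- \<xi> n"]] by (simp add: Psi_shift[OF fmB MB])
  show "(\<lambda>n. \<integral>\<^sup>+ s\<in>S. ennreal (norm ((Psi (shift A (\<xi> n)) t s - Psi B t s) ** P)) \<partial>lborel) \<longlonglongrightarrow> 0"
    using nn_integral_Psi_diff_tendsto_0[OF fmA fmB MAn ul S(1) \<open>c > 0\<close> \<open>\<alpha> > 0\<close> bdA[OF S(2)]] .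
  show "(\<lambda>n. \<integral>\<^sup>+ s\<in>S. ennreal (norm ((Psi (shift B (- \<xi> n)) t s - Psi A t s) ** P)) \<partial>lborel) \<longlonglongrightarrow> 0"
    using nn_integral_Psi_diff_tendsto_0[OF fundamental_matrix_shift[OF fmB] fm MBn
        uniform_limit_shift_back[OF ul] S(1) \<open>c > 0\<close> \<open>\<alpha> > 0\<close> bdB'[OF S(2)]] .
qed

text \<open>The alternative hypotheses become two implications, each pairing a bound with the
  half-line whose points \<open>s\<close>, apart from the endpoint \<open>t\<close>, it
  covers.\<close>

theorem lemma2p8:
  fixes A \<Phi> :: "real \<Rightarrow> complex ^ 'p ^ 'p"
    and P :: "complex ^ 'p ^ 'p"
    and c \<alpha> :: real
  assumes "almost_periodic A"
    and "fundamental_matrix A \<Phi>"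
    and "P ** P = P"
    and "\<And>t. P ** \<Phi> t = \<Phi> t ** P"
    and "c > 0" and "\<alpha> > 0"
  shows "((\<forall>t s. t > s \<longrightarrow> norm (Psi A t s ** P) \<le> c * exp (- \<alpha> * \<bar>t - s\<bar>))
            \<longrightarrow> integrally_bi_aa_past A P)
       \<and> ((\<forall>t s. t < s \<longrightarrow> norm (Psi A t s ** P) \<le> c * exp (- \<alpha> * \<bar>t - s\<bar>))
            \<longrightarrow> integrally_bi_aa_future A P)"
proof (intro conjI impI)
  note aa = almost_periodic_imp_almost_automorphic[OF assms(1)]
    and lim = nn_integral_Psi_shift_tendsto_0[OF assms(1,2,5,6)]
  assume bd: "\<forall>t s. t > s \<longrightarrow> norm (Psi A t s ** P) \<le> c * exp (- \<alpha> * \<bar>t - s\<bar>)"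
  show "integrally_bi_aa_past A P"
    unfolding integrally_bi_aa_past_def
    by (intro conjI allI impI aa; rule lim[where R = "(>)"]) (use bd in auto)
next
  note aa = almost_periodic_imp_almost_automorphic[OF assms(1)]
    and lim = nn_integral_Psi_shift_tendsto_0[OF assms(1,2,5,6)]
  assume bd: "\<forall>t s. t < s \<longrightarrow> norm (Psi A t s ** P) \<le> c * exp (- \<alpha> * \<bar>t - s\<bar>)"
  show "integrally_bi_aa_future A P"
    unfolding integrally_bi_aa_future_def
    by (intro conjI allI impI aa; rule lim[where R = "(<)"]) (use bd in auto)
qed

end
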